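(* Let $\mathcal A=\{a_1,\dots,a_x\}$ be a multiset of $x$ (not necessarily distinct) natural numbers, and for each $d$ let $\mathcal A_d=\#\{n\le x:\ d\mid a_n\}$. Let $h$ be a real-valued, non-negative multiplicative function with $0\le h(d)\le d$ for all square-free $d$, and for square-free $d$ define $r_d$ by $$\mathcal A_d=\frac{h(d)}{d}\,x+r_d .$$ Let $\mathcal P$ be a finite set of primes, let $\omega_{\mathcal P}(a)$ be the number of primes $p\in\mathcal P$ dividing $a$, and put $$\mu_{\mathcal P}=\sum_{p\in\mathcal P}\frac{h(p)}{p},\qquad \sigma_{\mathcal P}^2=\sum_{p\in\mathcal P}\frac{h(p)}{p}\Big(1-\frac{h(p)}{p}\Big),\qquad \sigma_{\mathcal P}\ge 0.$$ Then, uniformly for all natural numbers $k\le\sigma_{\mathcal P}^{2/3}$, we have $$\sum_{a\in\mathcal A}\big(\omega_{\mathcal P}(a)-\mu_{\mathcal P}\big)^k = C_k\,x\,\sigma_{\mathcal P}^k\Big(1+O\Big(\frac{k^3}{\sigma_{\mathcal P}^2}\Big)\Big)+O\Big(\mu_{\mathcal P}^k\sum_{d\in D_k(\mathcal P)}|r_d|\Big)$$ if $k$ is even, and $$\sum_{a\in\mathcal A}\big(\omega_{\mathcal P}(a)-\mu_{\mathcal P}\big)^k \ll C_k\,x\,\sigma_{\mathcal P}^k\,\frac{k^{3/2}}{\sigma_{\mathcal P}}+\mu_{\mathcal P}^k\sum_{d\in D_k(\mathcal P)}|r_d|$$ if $k$ is odd.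
   Context: For a natural number $k\ge1$, $C_k=\Gamma(k+1)/(2^{k/2}\,\Gamma(k/2+1))$. $D_k(\mathcal P)$ denotes the set of square-free integers which are the product of at most $k$ primes all from the set $\mathcal P$. Sums over $a\in\mathcal A$ are taken with multiplicity. The implied constants in $O(\cdot)$ and $\ll$ are absolute (independent of $\mathcal A$, $x$, $h$, $\mathcal P$ and $k$); $A\ll B$ means $|A|\le cB$ for an absolute constant $c$. *)

theory Defs
  imports "HOL-Analysis.Analysis" "HOL-Computational_Algebra.Squarefree"
begin

definition C_coeff :: "nat \<Rightarrow> real" where
  "C_coeff k = Gamma (real k + 1) / (2 powr (real k / 2) * Gamma (real k / 2 + 1))"

text \<open>Arithmetic functions live on the positive integers; the value at \<open>0\<close> is unconstrained.\<close>

definition multiplicative :: "(nat \<Rightarrow> real) \<Rightarrow> bool" where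
  "multiplicative h \<longleftrightarrow>
     h 1 = 1 \<and> (\<forall>m n. m > 0 \<longrightarrow> n > 0 \<longrightarrow> coprime m n \<longrightarrow> h (m * n) = h m * h n)"

definition count_div :: "nat multiset \<Rightarrow> nat \<Rightarrow> nat" where
  "count_div A d = size {#a \<in># A. d dvd a#}"

definition remainder :: "nat multiset \<Rightarrow> (nat \<Rightarrow> real) \<Rightarrow> nat \<Rightarrow> real" where
  "remainder A h d = real (count_div A d) - h d / real d * real (size A)"

definition omega_P :: "nat set \<Rightarrow> nat \<Rightarrow> nat" where
  "omega_P P a = card {p \<in> P. p dvd a}"

definition mu_P :: "(nat \<Rightarrow> real) \<Rightarrow> nat set \<Rightarrow> real" where
  "mu_P h P = (\<Sum>p\<in>P. h p / real p)"

definition sigma_P :: "(nat \<Rightarrow> real) \<Rightarrow> nat set \<Rightarrow> real" where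
  "sigma_P h P = sqrt (\<Sum>p\<in>P. h p / real p * (1 - h p / real p))"

text \<open>The empty product \<open>1\<close> belongs to \<open>D_set k P\<close>.\<close>

definition D_set :: "nat \<Rightarrow> nat set \<Rightarrow> nat set" where
  "D_set k P = {d. squarefree d \<and> prime_factors d \<subseteq> P \<and> card (prime_factors d) \<le> k}"

text \<open>Needed for sums over \<open>D_set k P\<close> not to collapse to \<open>0\<close> by convention.\<close>

lemma finite_D_set:
  assumes "finite P"
  shows "finite (D_set k P)"
proof -
  have "D_set k P \<subseteq> Prod ` Pow P"
  proof
    fix d assume d: "d \<in> D_set k P"
    then have sf: "squarefree d" "d \<noteq> 0"
      by (auto simp: D_set_def intro: ccontr)
    have "d = (\<Prod>p\<in>prime_factors d. p ^ multiplicity p d)"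
      using sf(2) prod_prime_factors[of d] by simp
    also have "\<dots> = \<Prod>(prime_factors d)"
      using sf squarefree_factorial_semiring'[of d]
      by (intro prod.cong) simp_all
    finally have "d = \<Prod>(prime_factors d)" .
    with d show "d \<in> Prod ` Pow P"
      by (auto simp: D_set_def)
  qed
  with assms show ?thesis
    by (meson finite_Pow_iff finite_imageI finite_subset)
qed

end

theory Submission
  imports Defs "HOL-Computational_Algebra.Formal_Laurent_Series"
begin

text \<open>
  The proof encodes the moments in exponential generating functions. For \<open>g p = h p / p\<close> and a natural
  number \<open>a\<close>, the series \<open>exp (t \<omega>(a))\<close> is the sum over \<open>T \<subseteq> P\<close> of \<open>[\<Prod>T dvd a] (exp t - 1) ^ card T\<close>.
  Summing over \<open>A\<close> and multiplying by \<open>exp (- \<mu> t)\<close>, the main terms of the counts give \<open>size A\<close> times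
  the product over \<open>p\<close> of the series of a centred Bernoulli variable with parameter \<open>g p\<close>: the model
  in which the events \<open>p dvd a\<close> are independent. The remainders get weights that vanish unless
  \<open>card T \<le> k\<close> and are at most \<open>(\<mu> + k) ^ k\<close>. Since \<open>k ^ 3 \<le> \<sigma>\<^sup>2 \<le> \<mu>\<close>, this is \<open>O(\<mu> ^ k)\<close>
  (\<open>moment_minus_model_bound\<close> and \<open>shifted_power_le\<close>).

  It remains to compare the \<open>k\<close>-th coefficient of the Bernoulli product with that of
  \<open>exp (\<sigma>\<^sup>2 t\<^sup>2 / 2)\<close>. Each factor differs from \<open>exp (v p t\<^sup>2 / 2)\<close>, where \<open>v p\<close> is its variance, by a
  series dominated coefficientwise by \<open>v p W\<close> with \<open>W = (t\<^sup>3 + t\<^sup>4 + \<dots>) / 2\<close>. Telescoping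
  (\<open>dominated_prod_diff\<close>), the products differ by at most \<open>exp (\<sigma>\<^sup>2 t\<^sup>2 / 2) (\<Prod>(1 + v p W) - 1)\<close>. In the
  Gaussian series a step of \<open>i\<close> down from index \<open>k\<close> costs about \<open>y ^ i\<close> with \<open>y = sqrt k / \<sigma>\<close>
  (\<open>gauss_fps_nth_le\<close>), so relative to the main term the error is the value of the second factor at
  \<open>y\<close>, where \<open>\<sigma>\<^sup>2 W(y)\<close> has the size \<open>\<sigma>\<^sup>2 y\<^sup>3 = k powr (3/2) / \<sigma> \<le> 1\<close>. This settles odd \<open>k\<close>. For even \<open>k\<close>
  only even powers of \<open>t\<close> count. Then the linear part \<open>\<sigma>\<^sup>2 W\<close> loses its cubic term and contributes
  \<open>\<sigma>\<^sup>2 y\<^sup>4\<close>, the higher parts contribute the square of \<open>\<sigma>\<^sup>2 y\<^sup>3\<close>, and both are \<open>O(k\<^sup>3 / \<sigma>\<^sup>2)\<close>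
  (\<open>bernoulli_sum_moment_approx\<close>).
\<close>

section \<open>Coefficientwise domination of power series\<close>

text \<open>The relation \<open>f \<preceq> f\<close> expresses that \<open>f\<close> has nonnegative coefficients.\<close>

definition dominated :: "real fps \<Rightarrow> real fps \<Rightarrow> bool" (infix "\<preceq>" 50) where
  "f \<preceq> g \<longleftrightarrow> (\<forall>n. \<bar>fps_nth f n\<bar> \<le> fps_nth g n)"

lemma dominatedD: "f \<preceq> g \<Longrightarrow> \<bar>fps_nth f n\<bar> \<le> fps_nth g n"
  by (simp add: dominated_def)

lemma dominated_refl_iff: "f \<preceq> f \<longleftrightarrow> (\<forall>n. 0 \<le> fps_nth f n)"
  by (metis abs_ge_zero abs_of_nonneg dominated_def order_refl order_trans)

lemma dominated_nonneg: "f \<preceq> g \<Longrightarrow> 0 \<le> fps_nth g n"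
  by (meson abs_ge_zero dominatedD order_trans)

lemma dominated_trans: "f \<preceq> g \<Longrightarrow> g \<preceq> h \<Longrightarrow> f \<preceq> h"
  unfolding dominated_def by (meson abs_ge_self order_trans)

lemma dominated_add: "f \<preceq> g \<Longrightarrow> f' \<preceq> g' \<Longrightarrow> f + f' \<preceq> g + g'"
  unfolding dominated_def fps_add_nth by (meson abs_triangle_ineq add_mono order_trans)

lemma dominated_mult:
  assumes "f \<preceq> g" "f' \<preceq> g'" shows "f * f' \<preceq> g * g'"
  unfolding dominated_def
proof
  fix n
  have "\<bar>fps_nth (f * f') n\<bar> \<le> (\<Sum>i=0..n. \<bar>fps_nth f i\<bar> * \<bar>fps_nth f' (n - i)\<bar>)"
    unfolding fps_mult_nth abs_mult[symmetric] by (rule sum_abs)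
  also have "\<dots> \<le> fps_nth (g * g') n"
    unfolding fps_mult_nth
    by (intro sum_mono mult_mono dominatedD assms dominated_nonneg[OF assms(1)] abs_ge_zero)
  finally show "\<bar>fps_nth (f * f') n\<bar> \<le> fps_nth (g * g') n" .
qed

lemma dominated_one: "1 \<preceq> 1"
  by (simp add: dominated_def)

lemma dominated_power: "f \<preceq> g \<Longrightarrow> f ^ n \<preceq> g ^ n"
  by (induction n) (auto intro: dominated_one dominated_mult)

lemma dominated_prod: "(\<And>p. p \<in> P \<Longrightarrow> f p \<preceq> g p) \<Longrightarrow> prod f P \<preceq> prod g P"
  by (induction P rule: infinite_finite_induct) (auto intro: dominated_one dominated_mult)

text \<open>Replacing the factors \<open>b p\<close> of a product by \<open>a p\<close> one at a time telescopes into
  \<open>a A - b B = (a - b) A + b (A - B)\<close>. When each replacement costs at most the relative error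
  \<open>D p\<close>, the total relative error is what multiplying out \<open>1 + D p\<close> gives.\<close>

lemma dominated_prod_diff:
  assumes "finite P"
    and "\<And>p. p \<in> P \<Longrightarrow> b p \<preceq> b p" "\<And>p. p \<in> P \<Longrightarrow> D p \<preceq> D p"
    and "\<And>p. p \<in> P \<Longrightarrow> a p - b p \<preceq> b p * D p"
  shows "prod a P - prod b P \<preceq> prod b P * ((\<Prod>p\<in>P. 1 + D p) - 1)"
  using assms
proof (induction P rule: finite_induct)
  case empty
  then show ?case by (simp add: dominated_def)
next
  case (insert q P)
  let ?A = "prod a P" and ?B = "prod b P" and ?U = "\<Prod>p\<in>P. 1 + D p"
  have IH: "?A - ?B \<preceq> ?B * (?U - 1)"
    using insert by auto
  have B: "?B \<preceq> ?B"
    by (rule dominated_prod) (use insert in auto)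
  have "(?A - ?B) + ?B \<preceq> ?B * (?U - 1) + ?B"
    by (rule dominated_add[OF IH B])
  then have A: "?A \<preceq> ?B * ?U"
    by (simp add: algebra_simps)
  have "(a q - b q) * ?A + b q * (?A - ?B) \<preceq> (b q * D q) * (?B * ?U) + b q * (?B * (?U - 1))"
    by (intro dominated_add dominated_mult A IH) (use insert in auto)
  then show ?case
    using insert.hyps by (simp add: algebra_simps)
qed

section \<open>Evaluation of truncated power series\<close>

text \<open>For nonnegative coefficients and \<open>y \<ge> 0\<close> the truncated value is submultiplicative: the product
  of two truncations contains all monomials of the truncated product. This bounds weighted
  coefficient sums of a product without any question of convergence.\<close>

definition trunc_eval :: "nat \<Rightarrow> real \<Rightarrow> real fps \<Rightarrow> real" where
  "trunc_eval k y f = (\<Sum>j\<le>k. fps_nth f j * y ^ j)"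

lemma trunc_eval_mult_le:
  assumes "f \<preceq> f" "g \<preceq> g" "0 \<le> y"
  shows "trunc_eval k y (f * g) \<le> trunc_eval k y f * trunc_eval k y g"
proof -
  let ?t = "\<lambda>i j. (fps_nth f i * y ^ i) * (fps_nth g j * y ^ j)"
  have nn: "0 \<le> ?t i j" for i j
    using assms by (simp add: dominated_nonneg)
  have "trunc_eval k y (f * g) = (\<Sum>n\<le>k. \<Sum>i\<le>n. ?t i (n - i))"
    unfolding trunc_eval_def fps_mult_nth sum_distrib_right atMost_atLeast0[symmetric]
  proof (intro sum.cong refl, goal_cases)
    case (1 n i)
    then have "y ^ n = y ^ i * y ^ (n - i)"
      by (simp flip: power_add)
    then show ?case by (simp add: algebra_simps)
  qed
  also have "\<dots> = (\<Sum>(i, j)\<in>{(i, j). i + j \<le> k}. ?t i j)"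
    by (rule sum.triangle_reindex_eq[symmetric])
  also have "\<dots> \<le> (\<Sum>(i, j)\<in>{..k} \<times> {..k}. ?t i j)"
    by (rule sum_mono2) (use nn in auto)
  also have "\<dots> = trunc_eval k y f * trunc_eval k y g"
    by (simp add: trunc_eval_def sum_product sum.cartesian_product)
  finally show ?thesis .
qed

lemma trunc_eval_nonneg: "f \<preceq> f \<Longrightarrow> 0 \<le> y \<Longrightarrow> 0 \<le> trunc_eval k y f"
  unfolding trunc_eval_def by (intro sum_nonneg mult_nonneg_nonneg dominated_nonneg) auto

lemma trunc_eval_one: "trunc_eval k y 1 = 1"
  by (simp add: trunc_eval_def fps_one_nth if_distrib[of "\<lambda>x. x * _"] cong: if_cong)

lemma trunc_eval_prod_le_exp:
  assumes "finite P" "\<And>p. p \<in> P \<Longrightarrow> D p \<preceq> D p" "0 \<le> y"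
  shows "trunc_eval k y (\<Prod>p\<in>P. 1 + D p) \<le> exp (\<Sum>p\<in>P. trunc_eval k y (D p))"
  using assms
proof (induction P rule: finite_induct)
  case empty
  then show ?case by (simp add: trunc_eval_one)
next
  case (insert q P)
  have nn: "1 + D p \<preceq> 1 + D p" if "p \<in> insert q P" for p
    using insert.prems(1)[OF that] dominated_one by (rule dominated_add[rotated])
  have "trunc_eval k y (\<Prod>p\<in>insert q P. 1 + D p)
      \<le> trunc_eval k y (1 + D q) * trunc_eval k y (\<Prod>p\<in>P. 1 + D p)"
    using insert.hyps
    by (simp del: prod.insert add: prod.insert)
       (intro trunc_eval_mult_le dominated_prod nn insert.prems; simp)
  also have "\<dots> \<le> exp (trunc_eval k y (D q)) * exp (\<Sum>p\<in>P. trunc_eval k y (D p))"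
  proof (intro mult_mono)
    have "trunc_eval k y (1 + D q) = trunc_eval k y 1 + trunc_eval k y (D q)"
      by (simp add: trunc_eval_def distrib_right sum.distrib)
    then show "trunc_eval k y (1 + D q) \<le> exp (trunc_eval k y (D q))"
      by (simp add: trunc_eval_one)
    show "0 \<le> trunc_eval k y (\<Prod>p\<in>P. 1 + D p)"
      by (intro trunc_eval_nonneg dominated_prod nn insert.prems) auto
  qed (use insert in auto)
  finally show ?case
    using insert.hyps by (simp add: exp_add)
qed

text \<open>The coefficients of \<open>\<Prod>(1 + D p)\<close> are to be bounded separately for its part linear in \<open>D\<close>
  and for the rest, so that only the rest is exposed to the bound by the exponential function.\<close>

lemma nonlinear_part_of_prod_nonneg:
  assumes "finite P" "\<And>p. p \<in> P \<Longrightarrow> D p \<preceq> D p"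
  shows "(\<Prod>p\<in>P. 1 + D p) - 1 - sum D P \<preceq> (\<Prod>p\<in>P. 1 + D p) - 1 - sum D P"
  using assms
proof (induction P rule: finite_induct)
  case empty
  then show ?case by (simp add: dominated_def)
next
  case (insert q P)
  let ?U = "\<Prod>p\<in>P. 1 + D p"
  have IH: "?U - 1 - sum D P \<preceq> ?U - 1 - sum D P"
    using insert by auto
  have Dq: "D q \<preceq> D q" using insert by auto
  have "sum D P \<preceq> sum D P"
    using insert.prems by (auto simp: dominated_refl_iff fps_sum_nth intro!: sum_nonneg)
  from dominated_add[OF IH this] have U: "?U - 1 \<preceq> ?U - 1"
    by simp
  from dominated_add[OF IH dominated_mult[OF Dq U]]
  show ?case
    using insert.hyps by (simp add: algebra_simps)
qed

section \<open>Centred Bernoulli variables against the Gaussian\<close>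

text \<open>The exponential generating function \<open>exp (v t\<^sup>2 / 2)\<close> of the moments of a centred Gaussian with
  variance \<open>v\<close>.\<close>

definition gauss_fps :: "real \<Rightarrow> real fps" where
  "gauss_fps v = fps_exp (v / 2) oo fps_X ^ 2"

lemma gauss_fps_nth:
  "fps_nth (gauss_fps v) n = (if even n then (v / 2) ^ (n div 2) / fact (n div 2) else 0)"
  by (simp add: gauss_fps_def fps_nth_compose_X_power)

lemma gauss_fps_nonneg: "0 \<le> v \<Longrightarrow> gauss_fps v \<preceq> gauss_fps v"
  by (simp add: dominated_refl_iff gauss_fps_nth)

lemma gauss_fps_prod: "(\<Prod>p\<in>P. gauss_fps (v p)) = gauss_fps (\<Sum>p\<in>P. v p)"
proof (induction P rule: infinite_finite_induct)
  case (insert q P)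
  then show ?case
    by (simp add: gauss_fps_def add_divide_distrib fps_exp_add_mult fps_compose_mult_distrib)
qed (auto simp: gauss_fps_def)

text \<open>The common majorant \<open>(t\<^sup>3 + t\<^sup>4 + \<dots>) / 2\<close> for the deviation of one Bernoulli factor from
  its Gaussian counterpart, in units of the variance. The constant \<open>1/2\<close> is chosen so that the exponent met later is at
  most \<open>1\<close>.\<close>

definition tail_fps :: "real fps" where
  "tail_fps = Abs_fps (\<lambda>n. if 3 \<le> n then 1 / 2 else 0)"

text \<open>The exponential generating function of the moments of \<open>X - g\<close>, where \<open>X\<close> is \<open>1\<close> with
  probability \<open>g\<close> and \<open>0\<close> otherwise.\<close>

definition bernoulli_fps :: "real \<Rightarrow> real fps" where
  "bernoulli_fps g = fps_const g * fps_exp (1 - g) + fps_const (1 - g) * fps_exp (- g)"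

text \<open>A centred Bernoulli variable is at most \<open>1\<close> in absolute value, so none of its higher moments
  exceeds its variance.\<close>

lemma abs_bernoulli_moment_le:
  fixes g :: real
  assumes "0 \<le> g" "g \<le> 1" "2 \<le> n"
  shows "\<bar>g * (1 - g) ^ n + (1 - g) * (- g) ^ n\<bar> \<le> g * (1 - g)"
proof -
  obtain m where n: "n = Suc (Suc m)"
    using assms(3) by (metis Suc_le_D numeral_2_eq_2 Suc_le_mono)
  have "\<bar>g * (1 - g) ^ n + (1 - g) * (- g) ^ n\<bar> \<le> g * (1 - g) ^ n + (1 - g) * g ^ n"
    using assms by (intro order_trans[OF abs_triangle_ineq]) (simp add: abs_mult power_abs)
  also have "\<dots> = g * (1 - g) * ((1 - g) * (1 - g) ^ m + g * g ^ m)"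
    by (simp add: n algebra_simps)
  also have "\<dots> \<le> g * (1 - g) * ((1 - g) * 1 + g * 1)"
    using assms by (intro mult_left_mono add_mono power_le_one) auto
  finally show ?thesis by simp
qed

text \<open>Mean and variance agree, so the difference starts at \<open>t\<^sup>3\<close>. From there on the Bernoulli
  coefficients are at most \<open>v / 3!\<close> and the Gaussian ones at most \<open>(v / 2)\<^sup>2 / 2! \<le> v / 8\<close>. Keeping the
  factor \<open>v\<close> is essential: it makes the errors add up to \<open>\<sigma>\<^sup>2\<close>, whatever the number of primes.\<close>

lemma bernoulli_fps_diff_gauss:
  fixes g :: real
  assumes g: "0 \<le> g" "g \<le> 1"
  defines "v \<equiv> g * (1 - g)"
  shows "bernoulli_fps g - gauss_fps v \<preceq> fps_const v * tail_fps"
  unfolding dominated_def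
proof
  fix n :: nat
  have v: "0 \<le> v" "v \<le> 1"
    using g by (auto simp: v_def intro: mult_le_one)
  have B: "fps_nth (bernoulli_fps g) n = (g * (1 - g) ^ n + (1 - g) * (- g) ^ n) / fact n" for n :: nat
    by (simp add: bernoulli_fps_def add_divide_distrib)
  consider "n = 0" | "n = 1" | "n = 2" | "3 \<le> n" by linarith
  then show "\<bar>fps_nth (bernoulli_fps g - gauss_fps v) n\<bar> \<le> fps_nth (fps_const v * tail_fps) n"
  proof cases
    case 4
    have "\<bar>fps_nth (bernoulli_fps g) n\<bar> \<le> v / fact n"
      using abs_bernoulli_moment_le[OF g, of n] 4 by (simp add: B v_def divide_right_mono)
    also have "\<dots> \<le> v / 6"
      using fact_mono[OF 4, where ?'a = real] v by (intro divide_left_mono) (auto simp: fact_numeral)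
    finally have 1: "\<bar>fps_nth (bernoulli_fps g) n\<bar> \<le> v / 6" .
    have 2: "\<bar>fps_nth (gauss_fps v) n\<bar> \<le> v / 8"
    proof (cases "even n")
      case True
      then obtain m where m: "n = 2 * m" by auto
      with 4 have m2: "2 \<le> m" by auto
      have "v ^ m \<le> v ^ 1"
        using v m2 by (intro power_decreasing) auto
      moreover have "(8::real) \<le> 2 ^ m * fact m"
        using mult_mono[OF power_increasing[OF m2, of "2::real"] fact_mono[OF m2, where ?'a = real]]
        by (simp add: fact_numeral)
      ultimately have "v ^ m / (2 ^ m * fact m) \<le> v ^ 1 / 8"
        using v by (intro frac_le) auto
      then show ?thesis
        using v by (simp add: gauss_fps_nth m power_divide)
    qed (use v in \<open>simp add: gauss_fps_nth\<close>)
    from 1 2 v have "\<bar>fps_nth (bernoulli_fps g - gauss_fps v) n\<bar> \<le> v / 2"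
      using abs_triangle_ineq4[of "fps_nth (bernoulli_fps g) n" "fps_nth (gauss_fps v) n"]
      by (simp add: field_simps)
    with 4 show ?thesis by (simp add: tail_fps_def)
  next
    case 3
    have "fps_nth (bernoulli_fps g) n = v / 2"
      unfolding B unfolding 3 v_def by (simp add: power2_eq_square algebra_simps)
    with 3 show ?thesis by (simp add: gauss_fps_nth tail_fps_def)
  qed (auto simp: B gauss_fps_nth tail_fps_def)
qed

section \<open>Ratios of Gaussian moments\<close>

lemma fact_le_power_mult_fact:
  assumes "b \<le> a" shows "(fact a :: real) \<le> real a ^ (a - b) * fact b"
  using assms
proof (induction a rule: dec_induct)
  case (step n)
  have "(fact (Suc n) :: real) \<le> real (Suc n) * (real n ^ (n - b) * fact b)"
    using step.IH by (simp add: mult_left_mono del: of_nat_Suc)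
  also have "\<dots> \<le> real (Suc n) * (real (Suc n) ^ (n - b) * fact b)"
    by (intro mult_left_mono mult_right_mono power_mono) auto
  finally show ?case
    using step.hyps by (simp add: Suc_diff_le algebra_simps)
qed simp

text \<open>For odd \<open>k\<close> the normalisation involves \<open>\<Gamma>\<close> at a half-integer, which logarithmic convexity
  compares with the neighbouring integers: \<open>\<Gamma>(x + 1/2)\<^sup>2 \<le> \<Gamma>(x) \<Gamma>(x + 1)\<close>.\<close>

lemma Gamma_half_step:
  fixes x :: real
  assumes "0 < x" shows "Gamma (x + 1 / 2) \<le> sqrt x * Gamma x"
proof -
  have pos: "Gamma x > 0" "Gamma (x + 1) > 0" "Gamma (x + 1 / 2) > 0"
    using assms by (simp_all add: Gamma_real_pos)
  have mid: "(1 - 1 / 2) * x + 1 / 2 * (x + 1) = x + 1 / 2"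
    by (simp add: field_simps)
  have "ln (Gamma (x + 1 / 2)) \<le> (1 - 1/2) * ln (Gamma x) + 1/2 * ln (Gamma (x + 1))"
    using convex_onD[OF log_convex_Gamma_real, of "1/2" x "x + 1"] assms
    by (simp add: mid[simplified])
  also have "Gamma (x + 1) = x * Gamma x"
    by (rule Gamma_plus1) (use assms in \<open>auto elim!: nonpos_Ints_cases\<close>)
  also have "(1 - 1/2) * ln (Gamma x) + 1/2 * ln (x * Gamma x) = ln (sqrt x * Gamma x)"
    using assms pos by (simp add: ln_mult ln_sqrt field_simps)
  finally show ?thesis
    using assms pos by simp
qed

text \<open>Descending from \<open>k/2\<close> to \<open>m/2\<close> in integer steps costs a factor at most \<open>k/2\<close> each. When \<open>k\<close> is
  odd there is in addition one half step from \<open>(k + 1)/2\<close>; its factor \<open>sqrt ((k + 1)/2)\<close> exceeds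
  \<open>sqrt (k/2)\<close>, which is where \<open>sqrt 2\<close> comes from.\<close>

lemma Gamma_half_integer_le:
  assumes "even m" "m \<le> k"
  shows "Gamma (real k / 2 + 1) \<le> sqrt 2 * sqrt (real k / 2) ^ (k - m) * fact (m div 2)"
proof -
  obtain b where m: "m = 2 * b" using assms(1) by auto
  show ?thesis
  proof (cases "even k")
    case True
    then obtain a where k: "k = 2 * a" by auto
    have "Gamma (real k / 2 + 1) = fact a"
      using Gamma_fact[of a, where 'a = real] by (simp add: k add.commute)
    also have "\<dots> \<le> real a ^ (a - b) * fact b"
      using assms by (intro fact_le_power_mult_fact) (auto simp: k m)
    also have "real a ^ (a - b) = sqrt (real k / 2) ^ (k - m)"
      by (simp add: k m power_mult flip: diff_mult_distrib2)
    also have "\<dots> * fact b \<le> sqrt 2 * \<dots> * fact b"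
      by (intro mult_right_mono) (auto simp: mult_le_cancel_right1)
    finally show ?thesis by (simp add: m)
  next
    case False
    then obtain a where k: "k = 2 * a + 1" by (auto elim: oddE)
    have ba: "b \<le> a" using assms by (auto simp: k m)
    have "Gamma (real k / 2 + 1) = Gamma ((real a + 1) + 1 / 2)"
      by (simp add: k add_divide_distrib)
    also have "\<dots> \<le> sqrt (real a + 1) * Gamma (1 + real a)"
      using Gamma_half_step[of "real a + 1"] by (simp add: add.commute)
    also have "\<dots> = sqrt (real a + 1) * fact a"
      by (simp only: Gamma_fact)
    also have "\<dots> \<le> sqrt (2 * (real k / 2)) * ((real k / 2) ^ (a - b) * fact b)"
    proof (intro mult_mono)
      have "fact a \<le> real a ^ (a - b) * fact b"
        by (rule fact_le_power_mult_fact[OF ba])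
      also have "\<dots> \<le> (real k / 2) ^ (a - b) * fact b"
        by (intro mult_right_mono power_mono) (auto simp: k)
      finally show "fact a \<le> (real k / 2) ^ (a - b) * fact b" .
    qed (auto simp: k)
    also have "\<dots> = sqrt 2 * (sqrt (real k / 2) * (sqrt (real k / 2) ^ 2) ^ (a - b)) * fact b"
      by (simp only: real_sqrt_mult real_sqrt_pow2 of_nat_0_le_iff zero_le_numeral
          divide_nonneg_nonneg mult.assoc)
    also have "sqrt (real k / 2) * (sqrt (real k / 2) ^ 2) ^ (a - b) = sqrt (real k / 2) ^ (k - m)"
      using ba by (simp only: k m flip: power_mult power_Suc)
         (rule arg_cong[where f = "\<lambda>n. _ ^ n"], auto)
    finally show ?thesis by (simp add: m)
  qed
qed

text \<open>For even \<open>k\<close> this is the \<open>k\<close>-th coefficient of \<open>exp (s\<^sup>2 t\<^sup>2 / 2)\<close>; for odd \<open>k\<close>, where that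
  coefficient vanishes, it interpolates.\<close>

definition gauss_moment :: "nat \<Rightarrow> real \<Rightarrow> real" where
  "gauss_moment k s = C_coeff k * s ^ k / fact k"

lemma gauss_moment_eq: "gauss_moment k s = s ^ k / (sqrt 2 ^ k * Gamma (real k / 2 + 1))"
proof -
  have "2 powr (real k / 2) = sqrt 2 ^ k"
    by (simp add: powr_half_sqrt[symmetric] powr_powr flip: powr_realpow)
  then show ?thesis
    using Gamma_fact[of k, where 'a = real]
    by (simp add: gauss_moment_def C_coeff_def add.commute)
qed

lemma gauss_moment_pos: "0 < s \<Longrightarrow> 0 < gauss_moment k s"
  by (simp add: gauss_moment_eq Gamma_real_pos)

lemma gauss_fps_nth_even:
  "even k \<Longrightarrow> fps_nth (gauss_fps (s\<^sup>2)) k = gauss_moment k s"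
  using Gamma_fact[of "k div 2", where 'a = real]
  by (auto elim!: evenE simp: gauss_moment_eq gauss_fps_nth power_mult power_divide add.commute)

text \<open>Lowering the index by \<open>i\<close> costs a factor \<open>y ^ i\<close> with \<open>y = sqrt k / s\<close>. Hence a convolution of
  the Gaussian with a nonnegative series \<open>f\<close> is at most a constant times the main term times the
  value of \<open>f\<close> at \<open>y\<close>.\<close>

lemma gauss_fps_nth_le:
  assumes "0 < s" "even m" "m \<le> k"
  shows "fps_nth (gauss_fps (s\<^sup>2)) m \<le> sqrt 2 * gauss_moment k s * (sqrt (real k) / s) ^ (k - m)"
proof -
  let ?\<Gamma> = "Gamma (real k / 2 + 1)" and ?J = "k - m"
  have G: "0 < ?\<Gamma>" by (simp add: Gamma_real_pos)
  have "fps_nth (gauss_fps (s\<^sup>2)) m = s ^ m / (sqrt 2 ^ m * fact (m div 2))"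
    using gauss_fps_nth_even[OF assms(2)] Gamma_fact[of "m div 2", where 'a = real] assms(2)
    by (auto elim!: evenE simp: gauss_moment_eq add.commute)
  also have "\<dots> = s ^ m / sqrt 2 ^ m * (1 / fact (m div 2))"
    by simp
  also have "\<dots> \<le> s ^ m / sqrt 2 ^ m * (sqrt 2 * sqrt (real k / 2) ^ ?J / ?\<Gamma>)"
    using Gamma_half_integer_le[OF assms(2,3)] G assms(1)
    by (intro mult_left_mono) (auto simp: field_simps)
  also have "\<dots> = sqrt 2 * gauss_moment k s * (sqrt (real k) / s) ^ ?J"
  proof -
    have e: "sqrt 2 ^ k = sqrt 2 ^ m * sqrt 2 ^ ?J" "s ^ k = s ^ m * s ^ ?J"
      using assms(3) by (simp_all flip: power_add)
    show ?thesis
      using G assms(1)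
      by (simp add: gauss_moment_eq e real_sqrt_divide power_divide field_simps)
  qed
  finally show ?thesis .
qed

section \<open>Moments of a sum of independent Bernoulli variables\<close>

lemma geometric_tail_le:
  fixes y :: real
  assumes "1 \<le> m" "0 \<le> y" "real k * y \<le> 1"
  shows "(\<Sum>j=m..k. y ^ j) \<le> 2 * y ^ m"
proof (cases "m \<le> k")
  case True
  with assms have "y \<le> real k * y"
    by (simp add: mult_le_cancel_right1)
  with assms have y1: "y \<le> 1" by simp
  have "(\<Sum>j=m..k. y ^ j) = y ^ m + (\<Sum>j=Suc m..k. y ^ j)"
    by (simp add: sum.atLeast_Suc_atMost[OF True])
  also have "(\<Sum>j=Suc m..k. y ^ j) \<le> (\<Sum>j=Suc m..k. y ^ Suc m)"
    using assms y1 by (intro sum_mono power_decreasing) auto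
  also have "\<dots> \<le> real k * y ^ Suc m"
    using assms by (simp add: mult_right_mono)
  also have "\<dots> \<le> y ^ m"
    using mult_right_mono[OF assms(3), of "y ^ m"] assms(2) by (simp add: algebra_simps)
  finally show ?thesis by simp
qed (use assms in simp)

text \<open>Without the odd indices the cubic term is missing, which gains a factor \<open>y\<close>.\<close>

lemma tail_fps_eval:
  assumes "0 \<le> y" "real k * y \<le> 1"
  shows "trunc_eval k y tail_fps \<le> y ^ 3"
    and "(\<Sum>j | j \<le> k \<and> even j. fps_nth tail_fps j * y ^ j) \<le> y ^ 4"
proof -
  have "trunc_eval k y tail_fps = (\<Sum>j=3..k. y ^ j / 2)"
    unfolding trunc_eval_def
    by (rule sum.mono_neutral_cong_right) (auto simp: tail_fps_def)
  with geometric_tail_le[of 3 y k] assms show "trunc_eval k y tail_fps \<le> y ^ 3"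
    by (simp flip: sum_divide_distrib)
  have "(\<Sum>j | j \<le> k \<and> even j. fps_nth tail_fps j * y ^ j)
      = (\<Sum>j\<in>{j \<in> {4..k}. even j}. y ^ j / 2)"
  proof (rule sum.mono_neutral_cong_right)
    have "fps_nth tail_fps j = 0" if "even j" "\<not> 4 \<le> j" for j
    proof -
      have "j \<noteq> 3" using that by auto
      with that show ?thesis by (simp add: tail_fps_def)
    qed
    then show "\<forall>j\<in>{j. j \<le> k \<and> even j} - {j \<in> {4..k}. even j}. fps_nth tail_fps j * y ^ j = 0"
      by auto
  qed (auto simp: tail_fps_def)
  also have "\<dots> \<le> (\<Sum>j=4..k. y ^ j / 2)"
    using assms by (intro sum_mono2) auto
  finally show "(\<Sum>j | j \<le> k \<and> even j. fps_nth tail_fps j * y ^ j) \<le> y ^ 4"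
    using geometric_tail_le[of 4 y k] assms by (simp flip: sum_divide_distrib)
qed

text \<open>With \<open>y = sqrt k / s\<close> one has \<open>s\<^sup>2 y\<^sup>3 = \<epsilon>\<close> and \<open>s\<^sup>2 y\<^sup>4 \<le> \<epsilon>\<^sup>2\<close>, and the hypothesis on \<open>k\<close> says both
  \<open>\<epsilon> \<le> 1\<close> and \<open>k y \<le> 1\<close>. Up to a constant, the relative error is at most the value at \<open>y\<close> of the part of \<open>\<Prod>(1 + D p) - 1\<close>
  with the parity of \<open>k\<close>, as the Gaussian has only even coefficients. For odd \<open>k\<close> it is at most
  \<open>exp \<epsilon> - 1 = O(\<epsilon>)\<close>. For even \<open>k\<close> this would lose a factor \<open>\<epsilon>\<close>; but then the linear part starts
  at \<open>s\<^sup>2 y\<^sup>4\<close> and the remaining part is at most \<open>exp \<epsilon> - 1 - \<epsilon> = O(\<epsilon>\<^sup>2)\<close>.\<close>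

lemma bernoulli_sum_moment_approx:
  fixes g :: "'a \<Rightarrow> real"
  assumes P: "finite P" and g: "\<And>p. p \<in> P \<Longrightarrow> 0 \<le> g p \<and> g p \<le> 1"
    and s: "s\<^sup>2 = (\<Sum>p\<in>P. g p * (1 - g p))" "0 < s"
    and k: "1 \<le> k" "real k * sqrt (real k) \<le> s"
  defines "M \<equiv> fps_nth (\<Prod>p\<in>P. bernoulli_fps (g p)) k"
    and "\<epsilon> \<equiv> real k * sqrt (real k) / s"
  shows "even k \<Longrightarrow> \<bar>M - gauss_moment k s\<bar> \<le> 4 * \<epsilon>\<^sup>2 * gauss_moment k s"
    and "odd k \<Longrightarrow> \<bar>M\<bar> \<le> 4 * \<epsilon> * gauss_moment k s"
proof -
  define v where "v p = g p * (1 - g p)" for p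
  define D where "D p = fps_const (v p) * tail_fps" for p
  define U where "U = (\<Prod>p\<in>P. 1 + D p)"
  define y where "y = sqrt (real k) / s"
  define u where "u = trunc_eval k y (sum D P)"
  let ?G = "gauss_moment k s"
  have v: "0 \<le> v p" if "p \<in> P" for p
    using g[OF that] by (simp add: v_def)
  have D: "D p \<preceq> D p" if "p \<in> P" for p
    using v[OF that] by (simp add: D_def dominated_refl_iff tail_fps_def)
  have sumD: "sum D P = fps_const (s\<^sup>2) * tail_fps"
    by (rule fps_ext) (simp add: D_def fps_sum_nth s v_def sum_distrib_right)
  have G: "0 < ?G" by (rule gauss_moment_pos[OF s(2)])
  have R: "U - 1 - sum D P \<preceq> U - 1 - sum D P"
    unfolding U_def by (rule nonlinear_part_of_prod_nonneg[OF P D])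
  have "sum D P \<preceq> sum D P"
    by (simp add: sumD dominated_refl_iff tail_fps_def)
  from dominated_add[OF R this] have U1: "U - 1 \<preceq> U - 1" by simp

  have \<epsilon>: "0 \<le> \<epsilon>" "\<epsilon> \<le> 1"
    using k s(2) by (simp_all add: \<epsilon>_def)
  have y: "0 \<le> y" "real k * y \<le> 1"
    using k s(2) by (simp_all add: y_def)
  have y3: "s\<^sup>2 * y ^ 3 = \<epsilon>"
    using s(2) by (simp add: y_def \<epsilon>_def power_divide power3_eq_cube power2_eq_square)
  have y4: "s\<^sup>2 * y ^ 4 \<le> \<epsilon>\<^sup>2"
  proof -
    have "s\<^sup>2 * y ^ 4 = \<epsilon>\<^sup>2 / real k"
      using s(2) k by (simp add: y_def \<epsilon>_def power_divide power4_eq_xxxx power2_eq_square)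
    also have "\<dots> \<le> \<epsilon>\<^sup>2"
      using k by (simp add: divide_le_eq mult_le_cancel_left1)
    finally show ?thesis .
  qed
  have u_eq: "u = s\<^sup>2 * trunc_eval k y tail_fps"
    by (simp add: u_def sumD trunc_eval_def sum_distrib_left mult.assoc)
  have u: "0 \<le> u" "u \<le> \<epsilon>"
  proof -
    show "0 \<le> u"
      unfolding u_def by (rule trunc_eval_nonneg) (use y \<open>sum D P \<preceq> sum D P\<close> in auto)
    have "u \<le> s\<^sup>2 * y ^ 3"
      unfolding u_eq by (rule mult_left_mono[OF tail_fps_eval(1)[OF y]]) simp
    then show "u \<le> \<epsilon>" by (simp add: y3)
  qed
  have eval_U: "trunc_eval k y U \<le> exp u"
  proof -
    have "(\<Sum>p\<in>P. trunc_eval k y (D p)) = u"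
      unfolding u_def trunc_eval_def fps_sum_nth sum_distrib_right by (rule sum.swap)
    then show ?thesis
      using trunc_eval_prod_le_exp[of P D y k] P D y(1) by (simp add: U_def)
  qed
  have "exp u \<le> 1 + u + u\<^sup>2"
    using exp_bound u \<epsilon> by auto
  with eval_U have eval_U: "trunc_eval k y U \<le> 1 + u + u\<^sup>2" by simp

  have "\<bar>M - fps_nth (gauss_fps (s\<^sup>2)) k\<bar> \<le> fps_nth (gauss_fps (s\<^sup>2) * (U - 1)) k"
  proof -
    have "(\<Prod>p\<in>P. bernoulli_fps (g p)) - (\<Prod>p\<in>P. gauss_fps (v p))
        \<preceq> (\<Prod>p\<in>P. gauss_fps (v p)) * (U - 1)"
      unfolding U_def
    proof (rule dominated_prod_diff[OF P gauss_fps_nonneg D])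
      fix p assume p: "p \<in> P"
      have "fps_const (v p) * tail_fps \<preceq> gauss_fps (v p) * D p"
      proof -
        have one: "1 \<preceq> gauss_fps (v p)"
          using v[OF p] by (auto simp: dominated_def gauss_fps_nth)
        from dominated_mult[OF one D[OF p]] show ?thesis by (simp add: D_def)
      qed
      then show "bernoulli_fps (g p) - gauss_fps (v p) \<preceq> gauss_fps (v p) * D p"
        using dominated_trans bernoulli_fps_diff_gauss[of "g p"] g[OF p] by (auto simp: v_def)
    qed (use v in auto)
    then show ?thesis
      by (simp add: gauss_fps_prod M_def s(1) v_def dominated_def)
  qed
  also have "\<dots> = (\<Sum>i\<le>k. fps_nth (U - 1) i * fps_nth (gauss_fps (s\<^sup>2)) (k - i))"
    by (simp only: mult.commute[of "gauss_fps _"] fps_mult_nth atMost_atLeast0)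
  also have "\<dots> = (\<Sum>i | i \<le> k \<and> even (k - i). fps_nth (U - 1) i * fps_nth (gauss_fps (s\<^sup>2)) (k - i))"
    by (rule sum.mono_neutral_right) (auto simp: gauss_fps_nth)
  also have "\<dots> \<le> (\<Sum>i | i \<le> k \<and> even (k - i). fps_nth (U - 1) i * (sqrt 2 * ?G * y ^ i))"
  proof (intro sum_mono mult_left_mono dominated_nonneg[OF U1])
    fix i assume "i \<in> {i. i \<le> k \<and> even (k - i)}"
    then show "fps_nth (gauss_fps (s\<^sup>2)) (k - i) \<le> sqrt 2 * ?G * y ^ i"
      using gauss_fps_nth_le[OF s(2), of "k - i" k] by (auto simp: y_def)
  qed
  also have "\<dots> = sqrt 2 * ?G * (\<Sum>i | i \<le> k \<and> even (k - i). fps_nth (U - 1) i * y ^ i)"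
    unfolding sum_distrib_left by (intro sum.cong) (auto simp: algebra_simps)
  finally have main: "\<bar>M - fps_nth (gauss_fps (s\<^sup>2)) k\<bar>
      \<le> sqrt 2 * ?G * (\<Sum>i | i \<le> k \<and> even (k - i). fps_nth (U - 1) i * y ^ i)" (is "_ \<le> _ * ?S") .
  \<comment> \<open>The constants: \<open>sqrt 2 \<le> 2\<close> from the Gaussian ratios and \<open>2\<close> from \<open>?S\<close>.\<close>
  have conclude: "\<bar>M - fps_nth (gauss_fps (s\<^sup>2)) k\<bar> \<le> 4 * e * ?G" if "?S \<le> 2 * e" "0 \<le> e" for e
  proof -
    note main
    also have "sqrt 2 * ?G * ?S \<le> 2 * ?G * (2 * e)"
    proof (intro mult_mono that(1))
      show "sqrt 2 \<le> 2" using sqrt2_less_2 by simp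
      show "0 \<le> ?S"
        by (intro sum_nonneg mult_nonneg_nonneg dominated_nonneg[OF U1]) (use y in auto)
    qed (use G in auto)
    finally show ?thesis by (simp add: algebra_simps)
  qed

  show "\<bar>M - ?G\<bar> \<le> 4 * \<epsilon>\<^sup>2 * ?G" if "even k"
  proof -
    have "{i. i \<le> k \<and> even (k - i)} = {i. i \<le> k \<and> even i}"
      using that by auto
    then have "?S = (\<Sum>i | i \<le> k \<and> even i. s\<^sup>2 * (fps_nth tail_fps i * y ^ i))
        + (\<Sum>i | i \<le> k \<and> even i. fps_nth (U - 1 - sum D P) i * y ^ i)"
      by (simp add: sumD algebra_simps flip: sum.distrib)
    also have "\<dots> \<le> s\<^sup>2 * y ^ 4 + trunc_eval k y (U - 1 - sum D P)"
    proof (rule add_mono)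
      show "(\<Sum>i | i \<le> k \<and> even i. s\<^sup>2 * (fps_nth tail_fps i * y ^ i)) \<le> s\<^sup>2 * y ^ 4"
        unfolding sum_distrib_left[symmetric] by (rule mult_left_mono[OF tail_fps_eval(2)[OF y]]) simp
      show "(\<Sum>i | i \<le> k \<and> even i. fps_nth (U - 1 - sum D P) i * y ^ i)
          \<le> trunc_eval k y (U - 1 - sum D P)"
        unfolding trunc_eval_def
        using y by (intro sum_mono2 mult_nonneg_nonneg dominated_nonneg[OF R]) auto
    qed
    also have "trunc_eval k y (U - 1 - sum D P) = trunc_eval k y U - trunc_eval k y 1 - u"
      by (simp only: trunc_eval_def u_def fps_sub_nth left_diff_distrib sum_subtractf)
    also have "\<dots> \<le> u\<^sup>2"
      using eval_U by (simp add: trunc_eval_one)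
    also have "u\<^sup>2 \<le> \<epsilon>\<^sup>2"
      using u by (intro power_mono) auto
    finally have "?S \<le> 2 * \<epsilon>\<^sup>2" using y4 by simp
    then show ?thesis
      using conclude[of "\<epsilon>\<^sup>2"] gauss_fps_nth_even[OF that] by simp
  qed

  show "\<bar>M\<bar> \<le> 4 * \<epsilon> * ?G" if "odd k"
  proof -
    have "?S \<le> trunc_eval k y (U - 1)"
      unfolding trunc_eval_def
      using y by (intro sum_mono2 mult_nonneg_nonneg dominated_nonneg[OF U1]) auto
    also have "\<dots> = trunc_eval k y U - trunc_eval k y 1"
      by (simp only: trunc_eval_def fps_sub_nth left_diff_distrib sum_subtractf)
    also have "\<dots> \<le> u + u\<^sup>2"
      using eval_U by (simp add: trunc_eval_one)
    also have "u\<^sup>2 \<le> u"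
      using u \<epsilon> by (simp add: power2_eq_square mult_left_le)
    finally have "?S \<le> 2 * \<epsilon>" using u by simp
    then show ?thesis
      using conclude[of \<epsilon>] \<epsilon> that by (simp add: gauss_fps_nth)
  qed
qed

section \<open>Squarefree products of primes\<close>

lemma multiplicative_prod:
  assumes "multiplicative h" "finite T" "\<And>p. p \<in> T \<Longrightarrow> prime p"
  shows "h (\<Prod>T) = (\<Prod>p\<in>T. h p)"
  using assms(2,3)
proof (induction T rule: finite_induct)
  case empty
  then show ?case using assms(1) by (simp add: multiplicative_def)
next
  case (insert q T)
  have "coprime q (\<Prod>T)"
    using insert by (intro prod_coprime_right) (auto intro: primes_coprime)
  moreover have "0 < q" "0 < \<Prod>T"
    using insert.prems prime_gt_0_nat by (auto intro: prod_pos)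
  ultimately have "h (q * \<Prod>T) = h q * h (\<Prod>T)"
    using assms(1) by (simp add: multiplicative_def)
  then show ?case using insert by simp
qed

lemma prod_primes_dvd_iff:
  fixes a :: nat
  assumes "finite T" "\<And>p. p \<in> T \<Longrightarrow> prime p"
  shows "\<Prod>T dvd a \<longleftrightarrow> (\<forall>p\<in>T. p dvd a)"
  using assms
proof (induction T rule: finite_induct)
  case (insert q T)
  have "coprime q (\<Prod>T)"
    using insert by (intro prod_coprime_right) (auto intro: primes_coprime)
  then have "q * \<Prod>T dvd a \<longleftrightarrow> q dvd a \<and> \<Prod>T dvd a"
    by (auto intro: divides_mult dest: dvd_mult_left dvd_mult_right)
  then show ?case using insert by simp
qed simp

lemma prime_factors_prod_primes:
  assumes "finite T" "\<And>p. p \<in> T \<Longrightarrow> prime (p :: nat)"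
  shows "prime_factors (\<Prod>T) = T"
proof -
  have "prime_factors (\<Prod>T) = \<Union> ((prime_factors \<circ> (\<lambda>p. p)) ` T)"
    using assms by (intro prime_factors_prod) (auto dest: assms(2))
  also have "\<dots> = T"
    using assms(2) by (auto simp: prime_prime_factors)
  finally show ?thesis .
qed

lemma sum_subsets_le_sum_D_set:
  assumes P: "finite P" "\<And>p. p \<in> P \<Longrightarrow> prime p" and f: "\<And>d. 0 \<le> f d"
  shows "(\<Sum>T | T \<subseteq> P \<and> card T \<le> k. f (\<Prod>T)) \<le> (\<Sum>d\<in>D_set k P. f d :: real)"
proof -
  let ?F = "{T. T \<subseteq> P \<and> card T \<le> k}"
  have pf: "prime_factors (\<Prod>T) = T" if "T \<in> ?F" for T
    using that P by (intro prime_factors_prod_primes) (auto dest: finite_subset)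
  have "(\<Sum>T\<in>?F. f (\<Prod>T)) = (\<Sum>d\<in>Prod ` ?F. f d)"
    using pf by (subst sum.reindex) (auto intro: inj_on_inverseI[where g = prime_factors])
  also have "\<dots> \<le> (\<Sum>d\<in>D_set k P. f d)"
  proof (rule sum_mono2)
    show "Prod ` ?F \<subseteq> D_set k P"
    proof (rule image_subsetI)
      fix T assume T: "T \<in> ?F"
      have "squarefree (\<Prod>T)"
        using T P by (intro squarefree_prod_coprime) (auto intro!: primes_coprime squarefree_prime)
      then show "\<Prod>T \<in> D_set k P"
        using T pf[OF T] by (simp add: D_set_def)
    qed
  qed (use P f in \<open>auto intro: finite_D_set\<close>)
  finally show ?thesis .
qed

section \<open>Comparing the moments with the independent model\<close>

text \<open>\<open>exp (t \<omega>(a))\<close> is the product over \<open>p \<in> P\<close> of \<open>1 + [p dvd a] (exp t - 1)\<close>; multiplying out turns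
  it into a combination of divisibility conditions.\<close>

lemma fps_exp_omega:
  assumes P: "finite P" "\<And>p. p \<in> P \<Longrightarrow> prime p"
  shows "fps_exp (real (omega_P P a))
    = (\<Sum>T\<in>Pow P. fps_const (of_bool (\<Prod>T dvd a)) * (fps_exp 1 - 1) ^ card T)"
proof -
  let ?b = "\<lambda>p. fps_const (of_bool (p dvd a) :: real)"
  have "fps_exp (real (omega_P P a)) = (\<Prod>p\<in>{p \<in> P. p dvd a}. fps_exp (1 :: real))"
    by (simp add: omega_P_def fps_exp_power_mult)
  also have "\<dots> = (\<Prod>p\<in>P. ?b p * (fps_exp 1 - 1) + 1)"
    using P by (subst prod.inter_filter) (auto intro!: prod.cong)
  also have "\<dots> = (\<Sum>T\<in>Pow P. (\<Prod>p\<in>T. ?b p * (fps_exp 1 - 1)))"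
    using P by (subst prod_add) auto
  also have "\<dots> = (\<Sum>T\<in>Pow P. fps_const (of_bool (\<Prod>T dvd a)) * (fps_exp 1 - 1) ^ card T)"
  proof (intro sum.cong refl)
    fix T assume T: "T \<in> Pow P"
    then have fin: "finite T" using P finite_subset by auto
    then have "(\<Prod>p\<in>T. ?b p) = fps_const (of_bool (\<forall>p\<in>T. p dvd a))"
      by (induction T rule: finite_induct) auto
    then show "(\<Prod>p\<in>T. ?b p * (fps_exp 1 - 1))
        = fps_const (of_bool (\<Prod>T dvd a)) * (fps_exp 1 - 1) ^ card T"
      using T P prod_primes_dvd_iff[OF fin, of a] by (auto simp: prod.distrib)
  qed
  finally show ?thesis .
qed

lemma sum_mset_divisor_sum:
  "(\<Sum>a\<in>#A. \<Sum>T\<in>F. of_bool (d T dvd a) * c T) = (\<Sum>T\<in>F. real (count_div A (d T)) * c T)"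
  by (induction A) (auto simp: count_div_def algebra_simps simp flip: sum.distrib intro!: sum.cong)

text \<open>These are the weights of the sets of \<open>n\<close> primes. They vanish for \<open>n > k\<close>, as \<open>exp t - 1\<close> has no
  constant term, so that only divisors with at most \<open>k\<close> prime factors contribute. The series is
  dominated by \<open>exp ((\<mu> + n) t)\<close>.\<close>

lemma sieve_coeff_bound:
  fixes \<mu> :: real and k :: nat
  assumes "0 \<le> \<mu>"
  defines "c \<equiv> \<lambda>n. fps_nth (fps_exp (- \<mu>) * (fps_exp 1 - 1) ^ n) k"
  shows "n \<le> k \<Longrightarrow> \<bar>c n\<bar> \<le> (\<mu> + real k) ^ k / fact k"
    and "k < n \<Longrightarrow> c n = 0"
proof -
  have "fps_exp (- \<mu>) \<preceq> fps_exp \<mu>"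
    using assms by (simp add: dominated_def power_abs)
  moreover have "fps_exp 1 - 1 \<preceq> fps_exp (1 :: real)"
    by (simp add: dominated_def fps_one_nth)
  ultimately have "fps_exp (- \<mu>) * (fps_exp 1 - 1) ^ n \<preceq> fps_exp \<mu> * fps_exp 1 ^ n"
    by (intro dominated_mult dominated_power)
  then have "\<bar>c n\<bar> \<le> fps_nth (fps_exp \<mu> * fps_exp 1 ^ n) k"
    unfolding c_def by (rule dominatedD)
  also have "\<dots> = (\<mu> + real n) ^ k / fact k"
    by (simp add: fps_exp_power_mult flip: fps_exp_add_mult)
  finally have "\<bar>c n\<bar> \<le> (\<mu> + real n) ^ k / fact k" .
  moreover have "(\<mu> + real n) ^ k / fact k \<le> (\<mu> + real k) ^ k / fact k" if "n \<le> k"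
    using that assms by (intro divide_right_mono power_mono) auto
  ultimately show "\<bar>c n\<bar> \<le> (\<mu> + real k) ^ k / fact k" if "n \<le> k"
    using that by force
  show "c n = 0" if "k < n"
  proof -
    have "fps_nth ((fps_exp 1 - 1 :: real fps) ^ n) j = 0" if "j \<le> k" for j
      using startsby_zero_power_prefix[of "fps_exp 1 - 1 :: real fps" n] that \<open>k < n\<close> by simp
    then show ?thesis by (simp add: c_def fps_mult_nth)
  qed
qed

lemma bernoulli_fps_eq:
  "bernoulli_fps g = fps_exp (- g) * (1 + fps_const g * (fps_exp 1 - 1))"
proof -
  have ring: "a * (X * Y) + c * X = X * (1 + a * (Y - 1))" if "a + c = 1" for a c X Y :: "real fps"
    using that by algebra
  have "fps_exp (1 - g) = fps_exp (- g) * fps_exp 1"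
    by (simp flip: fps_exp_add_mult)
  then show ?thesis
    unfolding bernoulli_fps_def by (simp only:) (rule ring, simp)
qed

lemma fps_exp_prod: "(\<Prod>p\<in>P. fps_exp (c p :: real)) = fps_exp (\<Sum>p\<in>P. c p)"
  by (induction P rule: infinite_finite_induct) (auto simp: fps_exp_add_mult)

text \<open>The moment is linear in the counts of multiples. Their main terms \<open>size A * \<Prod>h p / p\<close> recombine
  into the product of the Bernoulli factors, and what is left is a weighted sum of remainders.\<close>

lemma moment_minus_model_bound:
  fixes k :: nat
  assumes h: "multiplicative h" "\<And>p. p \<in> P \<Longrightarrow> 0 \<le> h p"
    and P: "finite P" "\<And>p. p \<in> P \<Longrightarrow> prime p"
  defines "\<mu> \<equiv> mu_P h P"
  defines "M \<equiv> fps_nth (\<Prod>p\<in>P. bernoulli_fps (h p / real p)) k"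
  shows "\<bar>(\<Sum>a\<in>#A. (real (omega_P P a) - \<mu>) ^ k) - fact k * M * real (size A)\<bar>
    \<le> (\<mu> + real k) ^ k * (\<Sum>d\<in>D_set k P. \<bar>remainder A h d\<bar>)"
proof -
  define c where "c n = fps_nth (fps_exp (- \<mu>) * (fps_exp 1 - 1) ^ n) k" for n
  let ?g = "\<lambda>p. h p / real p" and ?r = "remainder A h"
  have \<mu>: "0 \<le> \<mu>"
    unfolding \<mu>_def mu_P_def using h by (intro sum_nonneg divide_nonneg_nonneg) auto

  have "(\<Sum>a\<in>#A. (real (omega_P P a) - \<mu>) ^ k)
      = (\<Sum>a\<in>#A. \<Sum>T\<in>Pow P. of_bool (\<Prod>T dvd a) * (fact k * c (card T)))"
  proof (rule arg_cong[where f = sum_mset], rule image_mset_cong)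
    fix a
    have "(real (omega_P P a) - \<mu>) ^ k
        = fact k * fps_nth (fps_exp (- \<mu>) * fps_exp (real (omega_P P a))) k"
      by (simp flip: fps_exp_add_mult)
    also have "fps_exp (- \<mu>) * fps_exp (real (omega_P P a))
        = (\<Sum>T\<in>Pow P. fps_const (of_bool (\<Prod>T dvd a))
             * (fps_exp (- \<mu>) * (fps_exp 1 - 1) ^ card T))"
      using P by (simp add: fps_exp_omega sum_distrib_left mult.left_commute)
    also have "fact k * fps_nth \<dots> k
        = (\<Sum>T\<in>Pow P. of_bool (\<Prod>T dvd a) * (fact k * c (card T)))"
      unfolding fps_sum_nth sum_distrib_left
      by (simp only: fps_mult_left_const_nth c_def mult.left_commute[of "fact k"])
    finally show "(real (omega_P P a) - \<mu>) ^ k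
        = (\<Sum>T\<in>Pow P. of_bool (\<Prod>T dvd a) * (fact k * c (card T)))" .
  qed
  also have "\<dots> = (\<Sum>T\<in>Pow P. real (count_div A (\<Prod>T)) * (fact k * c (card T)))"
    by (rule sum_mset_divisor_sum)
  also have "\<dots> = (\<Sum>T\<in>Pow P. (\<Prod>p\<in>T. ?g p) * c (card T)) * (fact k * real (size A))
      + (\<Sum>T\<in>Pow P. ?r (\<Prod>T) * (fact k * c (card T)))"
    unfolding sum_distrib_right sum.distrib[symmetric]
  proof (intro sum.cong refl)
    fix T assume "T \<in> Pow P"
    then have "h (\<Prod>T) = (\<Prod>p\<in>T. h p)"
      using P h by (intro multiplicative_prod) (auto dest: finite_subset)
    then have "real (count_div A (\<Prod>T)) = (\<Prod>p\<in>T. ?g p) * real (size A) + ?r (\<Prod>T)"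
      by (simp add: remainder_def prod_dividef)
    then show "real (count_div A (\<Prod>T)) * (fact k * c (card T))
        = (\<Prod>p\<in>T. ?g p) * c (card T) * (fact k * real (size A)) + ?r (\<Prod>T) * (fact k * c (card T))"
      by (simp add: algebra_simps)
  qed
  also have "(\<Sum>T\<in>Pow P. (\<Prod>p\<in>T. ?g p) * c (card T)) = M"
  proof -
    have "(\<Prod>p\<in>P. bernoulli_fps (?g p))
        = fps_exp (- \<mu>) * (\<Prod>p\<in>P. fps_const (?g p) * (fps_exp 1 - 1) + 1)"
      by (simp add: bernoulli_fps_eq prod.distrib fps_exp_prod \<mu>_def mu_P_def sum_negf add.commute)
    also have "\<dots> = fps_exp (- \<mu>) * (\<Sum>T\<in>Pow P. \<Prod>p\<in>T. fps_const (?g p) * (fps_exp 1 - 1))"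
      using P by (subst prod_add) auto
    also have "\<dots> = (\<Sum>T\<in>Pow P. fps_const (\<Prod>p\<in>T. ?g p) * (fps_exp (- \<mu>) * (fps_exp 1 - 1) ^ card T))"
    proof -
      have "(\<Prod>p\<in>T. fps_const (?g p)) = fps_const (\<Prod>p\<in>T. ?g p)" for T
        by (induction T rule: infinite_finite_induct) auto
      then show ?thesis
        by (simp add: prod.distrib sum_distrib_left mult.left_commute)
    qed
    finally show ?thesis
      by (simp add: M_def fps_sum_nth c_def)
  qed
  finally have "\<bar>(\<Sum>a\<in>#A. (real (omega_P P a) - \<mu>) ^ k) - fact k * M * real (size A)\<bar>
      = \<bar>\<Sum>T\<in>Pow P. ?r (\<Prod>T) * (fact k * c (card T))\<bar>"
    by (simp add: algebra_simps)
  also have "\<dots> = \<bar>\<Sum>T | T \<subseteq> P \<and> card T \<le> k. ?r (\<Prod>T) * (fact k * c (card T))\<bar>"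
    using P sieve_coeff_bound(2)[OF \<mu>]
    by (intro arg_cong[where f = abs] sum.mono_neutral_right) (auto simp: c_def not_le)
  also have "\<dots> \<le> (\<Sum>T | T \<subseteq> P \<and> card T \<le> k. (\<mu> + real k) ^ k * \<bar>?r (\<Prod>T)\<bar>)"
  proof (rule order_trans[OF sum_abs], rule sum_mono)
    fix T assume "T \<in> {T. T \<subseteq> P \<and> card T \<le> k}"
    then have "\<bar>c (card T)\<bar> \<le> (\<mu> + real k) ^ k / fact k"
      using sieve_coeff_bound(1)[OF \<mu>] by (auto simp: c_def)
    then have "fact k * \<bar>c (card T)\<bar> \<le> (\<mu> + real k) ^ k"
      by (simp add: field_simps)
    from mult_right_mono[OF this, of "\<bar>?r (\<Prod>T)\<bar>"]
    show "\<bar>?r (\<Prod>T) * (fact k * c (card T))\<bar> \<le> (\<mu> + real k) ^ k * \<bar>?r (\<Prod>T)\<bar>"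
      by (simp add: abs_mult algebra_simps)
  qed
  also have "\<dots> \<le> (\<mu> + real k) ^ k * (\<Sum>d\<in>D_set k P. \<bar>?r d\<bar>)"
    unfolding sum_distrib_left[symmetric]
    using P \<mu> by (intro mult_left_mono sum_subsets_le_sum_D_set) auto
  finally show ?thesis .
qed

text \<open>\<open>(1 + k/\<mu>) ^ k \<le> exp (k\<^sup>2/\<mu>) \<le> exp 1\<close>, as \<open>k\<^sup>2 \<le> k\<^sup>3 \<le> \<mu>\<close>.\<close>

lemma shifted_power_le:
  fixes \<mu> :: real
  assumes "1 \<le> k" "real k ^ 3 \<le> \<mu>"
  shows "(\<mu> + real k) ^ k \<le> 3 * \<mu> ^ k"
proof -
  have "real k ^ 2 \<le> real k ^ 3"
    using assms(1) by (intro power_increasing) auto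
  with assms have k2: "real k ^ 2 \<le> \<mu>" by simp
  have "0 < real k ^ 2" using assms(1) by simp
  with k2 have \<mu>: "0 < \<mu>" by linarith
  have "(1 + real k / \<mu>) ^ k \<le> exp (real k / \<mu>) ^ k"
    using \<mu> by (intro power_mono exp_ge_add_one_self) auto
  also have "\<dots> = exp (real k ^ 2 / \<mu>)"
    by (simp add: power2_eq_square flip: exp_of_nat_mult)
  also have "\<dots> \<le> exp 1"
    using k2 \<mu> by simp
  also have "\<dots> \<le> 3" by (rule exp_le)
  finally have "\<mu> ^ k * (1 + real k / \<mu>) ^ k \<le> \<mu> ^ k * 3"
    using \<mu> by (intro mult_left_mono) auto
  moreover have "\<mu> + real k = \<mu> * (1 + real k / \<mu>)"
    using \<mu> by (simp add: field_simps)
  ultimately show ?thesis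
    by (simp add: power_mult_distrib mult.commute)
qed

section \<open>The moment estimate\<close>

lemma powr_three_halves: "0 \<le> x \<Longrightarrow> x powr (3/2) = x * sqrt x"
  using powr_add[of x 1 "1/2"] by (cases "x = 0") (auto simp: powr_half_sqrt)

theorem proposition3:
  "\<exists>c::real. c > 0 \<and>
     (\<forall>(A :: nat multiset) (h :: nat \<Rightarrow> real) (P :: nat set) (k :: nat).
        multiplicative h \<longrightarrow>
        (\<forall>d>0. 0 \<le> h d) \<longrightarrow>
        (\<forall>d. squarefree d \<longrightarrow> h d \<le> real d) \<longrightarrow>
        finite P \<longrightarrow> (\<forall>p\<in>P. prime p) \<longrightarrow>
        1 \<le> k \<longrightarrow> real k \<le> sigma_P h P powr (2/3) \<longrightarrow>
        (even k \<longrightarrow>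
           (\<exists>E1 E2 :: real.
              \<bar>E1\<bar> \<le> c * (real k ^ 3 / (sigma_P h P)\<^sup>2) \<and>
              \<bar>E2\<bar> \<le> c * (mu_P h P ^ k * (\<Sum>d\<in>D_set k P. \<bar>remainder A h d\<bar>)) \<and>
              (\<Sum>a\<in>#A. (real (omega_P P a) - mu_P h P) ^ k) =
                C_coeff k * real (size A) * sigma_P h P ^ k * (1 + E1) + E2)) \<and>
        (odd k \<longrightarrow>
           \<bar>\<Sum>a\<in>#A. (real (omega_P P a) - mu_P h P) ^ k\<bar> \<le>
             c * (C_coeff k * real (size A) * sigma_P h P ^ k * (real k powr (3/2) / sigma_P h P) +
                  mu_P h P ^ k * (\<Sum>d\<in>D_set k P. \<bar>remainder A h d\<bar>))))"
proof (rule exI[of _ 4], intro conjI allI impI)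
  fix A h P and k :: nat
  assume h: "multiplicative h" "\<forall>d>0. 0 \<le> h d" "\<forall>d. squarefree d \<longrightarrow> h d \<le> real d"
    and P: "finite P" "\<forall>p\<in>P. prime p"
    and k: "1 \<le> k" "real k \<le> sigma_P h P powr (2/3)"
  define s where "s = sigma_P h P"
  define \<mu> where "\<mu> = mu_P h P"
  define g where "g p = h p / real p" for p
  define M where "M = fps_nth (\<Prod>p\<in>P. bernoulli_fps (g p)) k"
  define \<epsilon> where "\<epsilon> = real k * sqrt (real k) / s"
  define S where "S = (\<Sum>a\<in>#A. (real (omega_P P a) - \<mu>) ^ k)"
  define R where "R = \<mu> ^ k * (\<Sum>d\<in>D_set k P. \<bar>remainder A h d\<bar>)"
  have h0: "0 \<le> h p" if "p \<in> P" for p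
    using that h P prime_gt_0_nat by auto
  have g: "0 \<le> g p \<and> g p \<le> 1" if "p \<in> P" for p
    using that h0[OF that] h P prime_gt_0_nat[of p] by (auto simp: g_def squarefree_prime)
  have s_eq: "s = sqrt (\<Sum>p\<in>P. g p * (1 - g p))"
    by (simp add: s_def sigma_P_def g_def)
  have v0: "0 \<le> (\<Sum>p\<in>P. g p * (1 - g p))"
    using g by (intro sum_nonneg mult_nonneg_nonneg) auto
  then have s0: "0 \<le> s" by (simp add: s_eq)
  have s: "0 < s"
    using k s0 by (cases "s = 0") (auto simp: s_def)
  have s2: "s\<^sup>2 = (\<Sum>p\<in>P. g p * (1 - g p))"
    using v0 by (simp add: s_eq)
  have ks: "real k * sqrt (real k) \<le> s"
  proof -
    have "real k powr (3/2) \<le> (s powr (2/3)) powr (3/2)"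
      using k by (intro powr_mono2) (auto simp: s_def)
    then show ?thesis
      using s by (simp add: powr_powr powr_three_halves)
  qed
  have k3: "(real k * sqrt (real k))\<^sup>2 = real k ^ 3"
    by (simp add: power_mult_distrib power2_eq_square power3_eq_cube)
  \<comment> \<open>The mean is at least the variance, so a bound on \<open>k\<close> by \<open>s\<close> is also one by \<open>\<mu>\<close>.\<close>
  have "real k ^ 3 \<le> \<mu>"
  proof -
    have "real k ^ 3 \<le> s\<^sup>2"
      unfolding k3[symmetric] using ks by (intro power_mono) auto
    also have "\<dots> \<le> (\<Sum>p\<in>P. g p)"
      unfolding s2 using g by (intro sum_mono mult_left_le) auto
    finally show ?thesis by (simp add: \<mu>_def mu_P_def g_def)
  qed
  then have "(\<mu> + real k) ^ k * (\<Sum>d\<in>D_set k P. \<bar>remainder A h d\<bar>) \<le> 3 * R"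
    unfolding R_def mult.assoc[symmetric]
    by (intro mult_right_mono shifted_power_le[OF k(1)] sum_nonneg) auto
  with moment_minus_model_bound[OF h(1) h0 P(1), of k A] P(2)
  have err: "\<bar>S - fact k * M * real (size A)\<bar> \<le> 3 * R"
    by (force simp: S_def M_def \<mu>_def g_def)
  then have R: "0 \<le> R" by linarith
  have G: "fact k * gauss_moment k s = C_coeff k * s ^ k"
    by (simp add: gauss_moment_def)
  note approx = bernoulli_sum_moment_approx[OF P(1) g s2 s k(1) ks, folded M_def \<epsilon>_def]

  show "\<exists>E1 E2. \<bar>E1\<bar> \<le> 4 * (real k ^ 3 / (sigma_P h P)\<^sup>2) \<and>
      \<bar>E2\<bar> \<le> 4 * (mu_P h P ^ k * (\<Sum>d\<in>D_set k P. \<bar>remainder A h d\<bar>)) \<and>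
      (\<Sum>a\<in>#A. (real (omega_P P a) - mu_P h P) ^ k) =
        C_coeff k * real (size A) * sigma_P h P ^ k * (1 + E1) + E2" if "even k"
  proof (intro exI conjI)
    \<comment> \<open>\<open>E1\<close> comes from the model alone, hence is meaningful even for empty \<open>A\<close>.\<close>
    let ?E1 = "M / gauss_moment k s - 1" and ?E2 = "S - fact k * M * real (size A)"
    have "?E1 = (M - gauss_moment k s) / gauss_moment k s"
      using gauss_moment_pos[OF s, of k] by (simp add: diff_divide_distrib)
    then have "\<bar>?E1\<bar> \<le> 4 * \<epsilon>\<^sup>2"
      using approx(1)[OF _ that] gauss_moment_pos[OF s, of k] by (simp add: divide_le_eq)
    then show "\<bar>?E1\<bar> \<le> 4 * (real k ^ 3 / (sigma_P h P)\<^sup>2)"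
      by (simp only: \<epsilon>_def power_divide k3 s_def)
    show "\<bar>?E2\<bar> \<le> 4 * (mu_P h P ^ k * (\<Sum>d\<in>D_set k P. \<bar>remainder A h d\<bar>))"
      using err R by (simp add: R_def \<mu>_def)
    have "C_coeff k * real (size A) * s ^ k * (1 + ?E1) = fact k * gauss_moment k s * real (size A) * (1 + ?E1)"
      by (simp only: G mult_ac)
    also have "\<dots> = fact k * M * real (size A)"
      using gauss_moment_pos[OF s, of k] by (simp add: field_simps)
    finally show "(\<Sum>a\<in>#A. (real (omega_P P a) - mu_P h P) ^ k) =
        C_coeff k * real (size A) * sigma_P h P ^ k * (1 + ?E1) + ?E2"
      by (simp add: S_def s_def \<mu>_def)
  qed

  show "\<bar>\<Sum>a\<in>#A. (real (omega_P P a) - mu_P h P) ^ k\<bar> \<le>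
      4 * (C_coeff k * real (size A) * sigma_P h P ^ k * (real k powr (3/2) / sigma_P h P) +
        mu_P h P ^ k * (\<Sum>d\<in>D_set k P. \<bar>remainder A h d\<bar>))" if "odd k"
  proof -
    have add_err: "\<bar>S\<bar> \<le> 4 * (X + R)" if "\<bar>fact k * M * real (size A)\<bar> \<le> 4 * X" for X
    proof -
      have "\<bar>S\<bar> \<le> \<bar>S - fact k * M * real (size A)\<bar> + \<bar>fact k * M * real (size A)\<bar>"
        using abs_triangle_ineq[of "S - fact k * M * real (size A)" "fact k * M * real (size A)"] by simp
      also have "\<dots> \<le> 3 * R + 4 * X"
        using err that by (rule add_mono)
      finally show ?thesis using R by simp
    qed
    have "\<bar>fact k * M * real (size A)\<bar> = fact k * real (size A) * \<bar>M\<bar>"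
      by (simp add: abs_mult)
    also have "\<dots> \<le> fact k * real (size A) * (4 * \<epsilon> * gauss_moment k s)"
      using approx(2)[OF _ that] by (intro mult_left_mono) auto
    also have "\<dots> = 4 * (fact k * gauss_moment k s * real (size A) * \<epsilon>)"
      by simp
    also have "\<dots> = 4 * (C_coeff k * real (size A) * s ^ k * (real k powr (3/2) / s))"
      by (simp add: G \<epsilon>_def powr_three_halves)
    finally have "\<bar>S\<bar> \<le> 4 * (C_coeff k * real (size A) * s ^ k * (real k powr (3/2) / s) + R)"
      by (rule add_err)
    then show ?thesis by (simp only: S_def s_def \<mu>_def R_def)
  qed
qed simp

end
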